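(* Let $1/2<p<1$, $q=1-p$, $F_K=p-q$, and let $F_*>0$ be the nonzero zero in $[0,1]$ of $F\mapsto\mathsf{U}(F,p)$. Then the unit interval is partitioned as $$[0,1]=[0,F_K]\cup(F_K,F_* )\cup\{F_*\}\cup(F_*,1],$$ and: (1) $\mathsf{U}(F,p)>0$ for $F\in(0,F_K]\cup(F_K,F_* )$; (2) $\mathsf{U}(F,p)<0$ for $F\in(F_*,1]$; (3) $\mathsf{U}(F_*,p)=0$ and $\mathsf{U}(0,p)=0$; (4) $\mathsf{U}(F,p)$ is maximised at $F=F_K=p-q$, so that $\frac{d\mathsf{U}(F,p)}{dF}\big|_{F=F_K}=0$; (5) $\mathsf{U}(1,p)=-\infty$.
   Context: For a binary game with i.i.d. outcomes $Z(I)\in\{-1,1\}$, $\mathsf{P}(Z(I)=1)=p$, $\mathsf{P}(Z(I)=-1)=q$, and wealth $W(N)=W(0)\prod_{I=1}^N(1+F Z(I))$ with $W(0)>0$ and bet fraction $F\in[0,1]$, the utility function is $$\mathsf{U}(F,p)=\mathsf{E}\left[\log\left|\frac{W(N)}{W(0)}\right|^{1/N}\right],$$ which equals $p\log(1+F)+q\log(1-F)$, with $\log$ the natural logarithm and $\log 0=-\infty$. *)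

theory Defs
  imports "HOL-Probability.Probability"
begin

text \<open>The game is played for \<open>N\<close> rounds, numbered \<open>1, \<dots>, N\<close>.\<close>

definition binary_game :: "'a measure \<Rightarrow> (nat \<Rightarrow> 'a \<Rightarrow> real) \<Rightarrow> nat \<Rightarrow> real \<Rightarrow> real \<Rightarrow> bool" where
  "binary_game M Z N p q \<longleftrightarrow>
     prob_space M \<and>
     prob_space.indep_vars M (\<lambda>_. borel) Z {1..N} \<and>
     (\<forall>I\<in>{1..N}. (\<forall>\<omega>\<in>space M. Z I \<omega> \<in> {-1, 1}) \<and>
        measure M {\<omega>\<in>space M. Z I \<omega> = 1} = p \<and>
        measure M {\<omega>\<in>space M. Z I \<omega> = -1} = q)"

definition wealth :: "real \<Rightarrow> (nat \<Rightarrow> 'a \<Rightarrow> real) \<Rightarrow> real \<Rightarrow> nat \<Rightarrow> 'a \<Rightarrow> real" where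
  "wealth W0 Z F N \<omega> = W0 * (\<Prod>I=1..N. 1 + F * Z I \<omega>)"

text \<open>Natural logarithm with the convention \<open>log 0 = -\<infinity>\<close>; it is only applied to
  nonnegative arguments.\<close>

definition ext_ln :: "real \<Rightarrow> ereal" where
  "ext_ln x = (if x = 0 then -\<infinity> else ereal (ln x))"

text \<open>Expectation of an extended-real random variable as the expectation of its positive part
  minus that of its negative part (\<open>e2ennreal\<close> maps negative values to \<open>0\<close>). It is meaningful
  unless both parts are infinite; for the utility below with \<open>F \<in> [0,1]\<close> the positive part is
  bounded by \<open>ln 2\<close>.\<close>

definition ext_expectation :: "'a measure \<Rightarrow> ('a \<Rightarrow> ereal) \<Rightarrow> ereal" where
  "ext_expectation M X =
     enn2ereal (\<integral>\<^sup>+ \<omega>. e2ennreal (X \<omega>) \<partial>M) - enn2ereal (\<integral>\<^sup>+ \<omega>. e2ennreal (- X \<omega>) \<partial>M)"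

text \<open>The dependence of the utility on \<open>p\<close> is through the law of \<open>Z\<close> under \<open>M\<close>.\<close>

definition utility :: "'a measure \<Rightarrow> (nat \<Rightarrow> 'a \<Rightarrow> real) \<Rightarrow> real \<Rightarrow> nat \<Rightarrow> real \<Rightarrow> ereal" where
  "utility M Z W0 N F =
     ext_expectation M (\<lambda>\<omega>. ext_ln (\<bar>wealth W0 Z F N \<omega> / W0\<bar> powr (1 / real N)))"

text \<open>Derivative of an extended-real-valued function at a point near which it is finite. The
  finiteness clause matters because \<open>real_of_ereal\<close> sends \<open>\<plusminus>\<infinity>\<close> to \<open>0\<close>.\<close>

definition has_ereal_derivative :: "(real \<Rightarrow> ereal) \<Rightarrow> real \<Rightarrow> real \<Rightarrow> bool" where
  "has_ereal_derivative f D x \<longleftrightarrow>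
     (\<forall>\<^sub>F y in nhds x. \<bar>f y\<bar> \<noteq> \<infinity>) \<and>
     ((\<lambda>y. real_of_ereal (f y)) has_real_derivative D) (at x)"

end

theory Submission
  imports Defs
begin

text \<open>Taking logarithms turns the wealth into a sum of identically distributed terms, so that
  on \<open>(-1, 1)\<close> the utility is \<open>u(F) = p ln (1 + F) + q ln (1 - F)\<close>; independence plays no role.
  Since \<open>u'(F) = (p - q - F) / ((1 + F) (1 - F))\<close>, \<open>u\<close> increases strictly up to \<open>p - q\<close> and
  decreases strictly afterwards, and it takes a negative value at \<open>1 - exp (- p ln 2 / q)\<close>;
  hence it has a single zero to the right of \<open>p - q\<close>.\<close>

section \<open>Calculus of the expected logarithmic growth of a single round\<close>

definition kelly :: "real \<Rightarrow> real \<Rightarrow> real \<Rightarrow> real" where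
  "kelly p q F = p * ln (1 + F) + q * ln (1 - F)"

lemma kelly_0 [simp]: "kelly p q 0 = 0"
  by (simp add: kelly_def)

lemma has_real_derivative_kelly:
  assumes "-1 < F" "F < 1" "p + q = 1"
  shows "(kelly p q has_real_derivative (p - q - F) / ((1 + F) * (1 - F))) (at F)"
proof -
  have "p / (1 + F) - q / (1 - F) = (p * (1 - F) - q * (1 + F)) / ((1 + F) * (1 - F))"
    using assms by (simp add: diff_frac_eq)
  also have "p * (1 - F) - q * (1 + F) = p - q - (p + q) * F"
    by (simp add: algebra_simps)
  finally have "p / (1 + F) - q / (1 - F) = (p - q - F) / ((1 + F) * (1 - F))"
    using assms by simp
  moreover have "((\<lambda>F. p * ln (1 + F) + q * ln (1 - F)) has_real_derivative
      p / (1 + F) - q / (1 - F)) (at F)"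
    using assms by (auto intro!: derivative_eq_intros)
  ultimately show ?thesis
    by (simp add: kelly_def[abs_def])
qed

lemma continuous_on_kelly:
  assumes "p + q = 1" "S \<subseteq> {-1<..<1}"
  shows "continuous_on S (kelly p q)"
  using assms has_real_derivative_kelly
  by (intro continuous_at_imp_continuous_on ballI) (force intro: DERIV_isCont)

lemma kelly_strict_increasing:
  assumes "-1 < a" "a < b" "b \<le> p - q" "b < 1" "p + q = 1"
  shows "kelly p q a < kelly p q b"
proof (rule DERIV_pos_imp_increasing_open[OF \<open>a < b\<close>])
  show "\<exists>y. (kelly p q has_real_derivative y) (at x) \<and> 0 < y" if "a < x" "x < b" for x
    using that assms has_real_derivative_kelly[of x p q]
    by (intro exI[of _ "(p - q - x) / ((1 + x) * (1 - x))"]) auto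
  show "continuous_on {a..b} (kelly p q)"
    using assms by (intro continuous_on_kelly) auto
qed

lemma kelly_strict_decreasing:
  assumes "-1 < a" "p - q \<le> a" "a < b" "b < 1" "p + q = 1"
  shows "kelly p q b < kelly p q a"
proof (rule DERIV_neg_imp_decreasing_open[OF \<open>a < b\<close>])
  show "\<exists>y. (kelly p q has_real_derivative y) (at x) \<and> y < 0" if "a < x" "x < b" for x
    using that assms has_real_derivative_kelly[of x p q]
    by (intro exI[of _ "(p - q - x) / ((1 + x) * (1 - x))"]) (auto intro!: divide_neg_pos)
  show "continuous_on {a..b} (kelly p q)"
    using assms by (intro continuous_on_kelly) auto
qed

lemma kelly_has_zero:
  assumes "0 < q" "q < p" "p + q = 1"
  obtains z where "p - q < z" "z < 1" "kelly p q z = 0"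
proof -
  \<comment> \<open>\<open>b\<close> solves \<open>q * ln (1 - b) = - (p * ln 2)\<close>, which
    offsets the bound \<open>p * ln 2\<close> on the first term; as \<open>b < 1\<close>, that bound
    is strict and the sum is negative.\<close>
  define b where "b = 1 - exp (- (p * ln 2 / q))"
  have b: "0 < b" "b < 1"
    using assms by (auto simp: b_def)
  have "q * ln (1 - b) = - (p * ln 2)"
    using assms by (simp add: b_def)
  moreover have "p * ln (1 + b) < p * ln 2"
    using assms b by simp
  ultimately have neg: "kelly p q b < 0"
    by (simp add: kelly_def)
  have pos: "0 < kelly p q c" if "0 < c" "c \<le> p - q" for c
    using kelly_strict_increasing[of 0 c p q] that assms by simp
  \<comment> \<open>Otherwise \<open>b\<close> would lie in the range where \<open>pos\<close> makes
    the function positive.\<close>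
  have "p - q < b"
    using pos[of b] b neg by force
  then obtain z where z: "p - q \<le> z" "z \<le> b" "kelly p q z = 0"
    using IVT2'[of "kelly p q" b 0 "p - q"] neg pos[of "p - q"] b assms
      continuous_on_kelly[of p q "{p - q..b}"] by fastforce
  \<comment> \<open>The intermediate value theorem gives only a weak inequality; the positive value
    at \<open>p - q\<close> makes it strict.\<close>
  moreover have "z \<noteq> p - q"
    using z pos[of "p - q"] assms by force
  ultimately show thesis
    using that[of z] b by simp
qed

section \<open>Expectations of extended-real random variables\<close>

lemma ext_expectation_ereal:
  assumes "integrable M f"
  shows "ext_expectation M (\<lambda>\<omega>. ereal (f \<omega>)) = ereal (integral\<^sup>L M f)"
proof -
  have "(\<integral>\<^sup>+ \<omega>. ennreal (f \<omega>) \<partial>M) \<noteq> \<infinity>" "(\<integral>\<^sup>+ \<omega>. ennreal (- f \<omega>) \<partial>M) \<noteq> \<infinity>"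
    using assms by (auto simp: real_integrable_def)
  \<comment> \<open>Both parts are finite, so their difference is one of real numbers and agrees
    with the Lebesgue integral.\<close>
  then obtain a b where ab: "0 \<le> a" "(\<integral>\<^sup>+ \<omega>. ennreal (f \<omega>) \<partial>M) = ennreal a"
    "0 \<le> b" "(\<integral>\<^sup>+ \<omega>. ennreal (- f \<omega>) \<partial>M) = ennreal b"
    by (metis ennreal_cases infinity_ennreal_def)
  then show ?thesis
    using assms by (simp add: ext_expectation_def real_lebesgue_integral_def
      enn2ereal_ennreal e2ennreal_ereal)
qed

lemma ext_expectation_cong:
  assumes "\<And>\<omega>. \<omega> \<in> space M \<Longrightarrow> X \<omega> = Y \<omega>"
  shows "ext_expectation M X = ext_expectation M Y"
  unfolding ext_expectation_def using assms by (simp cong: nn_integral_cong)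

text \<open>Meant for the bet \<open>F = 1\<close>. The finite positive part excludes
  \<open>\<infinity> - \<infinity>\<close>, which \<open>ereal\<close> evaluates to
  \<open>\<infinity>\<close>.\<close>

lemma ext_expectation_minus_infinity:
  assumes "(\<integral>\<^sup>+ \<omega>. e2ennreal (X \<omega>) \<partial>M) < \<infinity>" "(\<integral>\<^sup>+ \<omega>. e2ennreal (- X \<omega>) \<partial>M) = \<infinity>"
  shows "ext_expectation M X = - \<infinity>"
  using assms by (cases "\<integral>\<^sup>+ \<omega>. e2ennreal (X \<omega>) \<partial>M")
    (auto simp: ext_expectation_def enn2ereal_ennreal)

section \<open>Utility of the binary game\<close>

context
  fixes M :: "'a measure" and Z N p q
  assumes game: "binary_game M Z N p q"
begin

interpretation prob_space M
  using game by (simp add: binary_game_def)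

lemma binary_game_measurable:
  "I \<in> {1..N} \<Longrightarrow> Z I \<in> borel_measurable M"
  using game unfolding binary_game_def indep_vars_def by blast

lemma binary_game_values:
  "I \<in> {1..N} \<Longrightarrow> \<omega> \<in> space M \<Longrightarrow> Z I \<omega> = -1 \<or> Z I \<omega> = 1"
  using game by (auto simp: binary_game_def)

lemma binary_game_sets:
  "I \<in> {1..N} \<Longrightarrow> {\<omega> \<in> space M. Z I \<omega> = c} \<in> sets M"
  using binary_game_measurable[of I] by measurable

text \<open>Since \<open>Z I\<close> takes two values, \<open>g (Z I \<omega>)\<close> is a
  combination of the indicators of winning and losing round \<open>I\<close>, and these integrate to
  \<open>p\<close> and \<open>q\<close>.\<close>

lemma binary_game_has_expectation:
  fixes g :: "real \<Rightarrow> real"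
  assumes "I \<in> {1..N}"
  shows "integrable M (\<lambda>\<omega>. g (Z I \<omega>))" "expectation (\<lambda>\<omega>. g (Z I \<omega>)) = p * g 1 + q * g (-1)"
proof -
  let ?A = "\<lambda>c. {\<omega> \<in> space M. Z I \<omega> = c}"
  let ?h = "\<lambda>\<omega>. indicator (?A 1) \<omega> * g 1 + indicator (?A (-1)) \<omega> * g (-1)"
  have eq: "g (Z I \<omega>) = ?h \<omega>" if "\<omega> \<in> space M" for \<omega>
    using binary_game_values[OF assms that] that by (auto simp: indicator_def)
  have meas: "prob (?A 1) = p" "prob (?A (-1)) = q"
    using game assms unfolding binary_game_def by blast+
  have int: "integrable M (indicator (?A c) :: 'a \<Rightarrow> real)" for c
    using binary_game_sets[OF assms] by (simp add: emeasure_eq_measure)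
  have "integrable M ?h"
    using int by simp
  then show "integrable M (\<lambda>\<omega>. g (Z I \<omega>))"
    using eq by (simp cong: Bochner_Integration.integrable_cong)
  have "expectation (\<lambda>\<omega>. g (Z I \<omega>)) = expectation ?h"
    using eq by (intro Bochner_Integration.integral_cong) auto
  also have "\<dots> = p * g 1 + q * g (-1)"
    using int meas binary_game_sets[OF assms] by simp
  finally show "expectation (\<lambda>\<omega>. g (Z I \<omega>)) = p * g 1 + q * g (-1)" .
qed

lemma utility_eq_kelly:
  assumes "N \<ge> 1" "W0 > 0" "-1 < F" "F < 1"
  shows "utility M Z W0 N F = ereal (kelly p q F)"
proof -
  have "ext_ln (\<bar>wealth W0 Z F N \<omega> / W0\<bar> powr (1 / real N)) =
      ereal ((\<Sum>I=1..N. ln (1 + F * Z I \<omega>)) / real N)" if "\<omega> \<in> space M" for \<omega>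
  proof -
    \<comment> \<open>As \<open>F\<close> lies strictly between -1 and 1, a single round can neither
      ruin the player nor turn the wealth negative.\<close>
    have pos: "0 < 1 + F * Z I \<omega>" if "I \<in> {1..N}" for I
      using binary_game_values[OF that \<open>\<omega> \<in> space M\<close>] assms by auto
    then have "0 < (\<Prod>I=1..N. 1 + F * Z I \<omega>)"
      by (intro prod_pos) blast
    moreover have "ln (\<Prod>I=1..N. 1 + F * Z I \<omega>) = (\<Sum>I=1..N. ln (1 + F * Z I \<omega>))"
      using pos by (intro ln_prod) force+
    \<comment> \<open>A finite product vanishes only if a factor does, so \<open>ext_ln\<close> is
      on its real branch.\<close>
    moreover have "\<forall>I\<in>{1..N}. 1 + F * Z I \<omega> \<noteq> 0"
      using pos by force
    ultimately show ?thesis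
      using assms by (simp add: ext_ln_def wealth_def ln_powr)
  qed
  then have "utility M Z W0 N F =
      ext_expectation M (\<lambda>\<omega>. ereal ((\<Sum>I=1..N. ln (1 + F * Z I \<omega>)) / real N))"
    unfolding utility_def by (rule ext_expectation_cong)
  also have "\<dots> = ereal (expectation (\<lambda>\<omega>. (\<Sum>I=1..N. ln (1 + F * Z I \<omega>)) / real N))"
    using binary_game_has_expectation(1)[where g = "\<lambda>z. ln (1 + F * z)"]
    by (intro ext_expectation_ereal integrable_divide_zero Bochner_Integration.integrable_sum)
  also have "expectation (\<lambda>\<omega>. (\<Sum>I=1..N. ln (1 + F * Z I \<omega>)) / real N) =
      (\<Sum>I=1..N. expectation (\<lambda>\<omega>. ln (1 + F * Z I \<omega>))) / real N"
    using binary_game_has_expectation(1)[where g = "\<lambda>z. ln (1 + F * z)"] by simp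
  \<comment> \<open>All \<open>N\<close> summands have the same expectation, and the exponent
    \<open>1 / N\<close> of the utility averages them.\<close>
  also have "\<dots> = kelly p q F"
    using assms binary_game_has_expectation(2)[where g = "\<lambda>z. ln (1 + F * z)"]
    by (simp add: kelly_def)
  finally show ?thesis .
qed

text \<open>Betting everything, one loss means ruin. Losing the first round has probability
  \<open>q > 0\<close>, so the negative part has infinite integral, while the positive part stays
  below \<open>ln 2\<close>.\<close>

lemma utility_1:
  assumes "N \<ge> 1" "W0 > 0" "q > 0"
  shows "utility M Z W0 N 1 = - \<infinity>"
proof -
  let ?X = "\<lambda>\<omega>. ext_ln (\<bar>wealth W0 Z 1 N \<omega> / W0\<bar> powr (1 / real N))"
  let ?A = "{\<omega> \<in> space M. Z 1 \<omega> = -1}"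
  have ruin: "?X \<omega> = - \<infinity>" if "I \<in> {1..N}" "Z I \<omega> = -1" for I \<omega>
  proof -
    have "(\<Prod>I=1..N. 1 + Z I \<omega>) = 0"
      using that by (intro prod_zero) force+
    \<comment> \<open>\<open>0 powr (1 / real N)\<close> is \<open>0\<close>, so ruin reaches the
      infinite branch of \<open>ext_ln\<close>.\<close>
    then show ?thesis
      by (simp add: ext_ln_def wealth_def)
  qed
  have le: "?X \<omega> \<le> ereal (ln 2)" if "\<omega> \<in> space M" for \<omega>
  proof (cases "\<exists>I\<in>{1..N}. Z I \<omega> = -1")
    case True
    then show ?thesis
      using ruin by auto
  next
    case False
    \<comment> \<open>With no loss the wealth doubles in every round, and the \<open>N\<close>-th
      root of the growth \<open>2 ^ N\<close> has logarithm \<open>ln 2\<close>.\<close>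
    then have "(\<Prod>I=1..N. 1 + Z I \<omega>) = (\<Prod>I=1..N. 2)"
      using binary_game_values that by (intro prod.cong) force+
    then show ?thesis
      using assms by (simp add: ext_ln_def wealth_def ln_powr ln_realpow)
  qed
  have "(\<integral>\<^sup>+ \<omega>. e2ennreal (?X \<omega>) \<partial>M) \<le> (\<integral>\<^sup>+ \<omega>. e2ennreal (ereal (ln 2)) \<partial>M)"
    using le by (intro nn_integral_mono e2ennreal_mono) auto
  also have "\<dots> < \<infinity>"
    by (simp add: emeasure_space_1)
  finally have fin: "(\<integral>\<^sup>+ \<omega>. e2ennreal (?X \<omega>) \<partial>M) < \<infinity>" .
  have "prob ?A = q"
    using game \<open>N \<ge> 1\<close> unfolding binary_game_def by force
  \<comment> \<open>The negative part is bounded below by \<open>\<infinity>\<close> times the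
    indicator of losing round 1.\<close>
  then have "\<infinity> = \<infinity> * emeasure M ?A"
    using \<open>q > 0\<close> by (simp add: emeasure_eq_measure ennreal_top_mult)
  also have "\<dots> = (\<integral>\<^sup>+ \<omega>. \<infinity> * indicator ?A \<omega> \<partial>M)"
    using binary_game_sets[of 1 "-1"] \<open>N \<ge> 1\<close> by (subst nn_integral_cmult_indicator) auto
  also have "\<dots> \<le> (\<integral>\<^sup>+ \<omega>. e2ennreal (- ?X \<omega>) \<partial>M)"
    using ruin[of 1] \<open>N \<ge> 1\<close> by (intro nn_integral_mono) (auto simp: indicator_def)
  finally have "(\<integral>\<^sup>+ \<omega>. e2ennreal (- ?X \<omega>) \<partial>M) = \<infinity>"
    by (simp add: top_unique)
  with fin show ?thesis
    unfolding utility_def by (rule ext_expectation_minus_infinity)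
qed

end

section \<open>Signs, maximum and derivative of the utility\<close>

theorem proposition3p9:
  fixes M :: "'a measure" and Z :: "nat \<Rightarrow> 'a \<Rightarrow> real" and N :: nat
    and W0 p q F_K :: real and U :: "real \<Rightarrow> ereal"
  assumes "1/2 < p" and "p < 1" and "q = 1 - p" and "F_K = p - q"
    and "N \<ge> 1" and "W0 > 0"
    and "binary_game M Z N p q"
    and "U = utility M Z W0 N"
  shows "\<exists>F_star. {F \<in> {0..1}. F \<noteq> 0 \<and> U F = 0} = {F_star} \<and>
    partition_on {0..1} {{0..F_K}, {F_K<..<F_star}, {F_star}, {F_star<..1}} \<and>
    (\<forall>F \<in> {0<..F_K} \<union> {F_K<..<F_star}. U F > 0) \<and>
    (\<forall>F \<in> {F_star<..1}. U F < 0) \<and>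
    U F_star = 0 \<and> U 0 = 0 \<and>
    is_arg_max U (\<lambda>F. F \<in> {0..1}) F_K \<and>
    has_ereal_derivative U 0 F_K \<and>
    U 1 = -\<infinity>"
proof -
  have q: "0 < q" "q < p" "p + q = 1" and FK: "0 < F_K" "F_K < 1" "F_K = p - q"
    using assms by auto
  obtain z where z: "F_K < z" "z < 1" "kelly p q z = 0"
    using kelly_has_zero[OF q] FK(3) by auto
  have U: "U F = ereal (kelly p q F)" if "-1 < F" "F < 1" for F
    using utility_eq_kelly assms that by simp
  have U1: "U 1 = - \<infinity>"
    using utility_1 assms q by simp
  \<comment> \<open>Up to \<open>F_K\<close> the value increases from the zero at \<open>0\<close>;
    beyond \<open>F_K\<close> it decreases towards the zero at \<open>z\<close>.\<close>
  have pos: "U F > 0" if "0 < F" "F < z" for F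
  proof (cases "F \<le> F_K")
    case True
    then show ?thesis
      using kelly_strict_increasing[of 0 F p q] that FK q U[of F] by simp
  next
    case False
    then show ?thesis
      using kelly_strict_decreasing[of F p q z] that FK q z U[of F] by simp
  qed
  \<comment> \<open>\<open>F = 1\<close> is separate: \<open>ln 0\<close> is some real number in
    \<open>kelly\<close>, so only \<open>U1\<close> records the value \<open>-\<infinity>\<close>
    there.\<close>
  have neg: "U F < 0" if "z < F" "F \<le> 1" for F
    using kelly_strict_decreasing[of z p q F] that FK q z U[of F] U1 by (cases "F = 1") auto
  have zero: "U z = 0" "U 0 = 0"
    using U[of z] U[of 0] z FK by simp_all
  have "{F \<in> {0..1}. F \<noteq> 0 \<and> U F = 0} = {z}"
  proof (intro equalityI subsetI)
    fix F assume "F \<in> {F \<in> {0..1}. F \<noteq> 0 \<and> U F = 0}"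
    \<comment> \<open>By trichotomy at \<open>z\<close>: a nonzero bet below \<open>z\<close> has
      positive utility, one above \<open>z\<close> negative utility.\<close>
    then show "F \<in> {z}"
      using pos[of F] neg[of F] by (cases F z rule: linorder_cases) auto
  qed (use zero z FK in auto)
  \<comment> \<open>Blocks of a partition must be nonempty, which \<open>0 < F_K < z < 1\<close>
    ensures.\<close>
  moreover have "partition_on {0..1} {{0..F_K}, {F_K<..<z}, {z}, {z<..1}}"
    using z FK by (intro partition_onI) (auto simp: disjnt_def)
  moreover have "is_arg_max U (\<lambda>F. F \<in> {0..1}) F_K"
  proof -
    have "U F \<le> U F_K" if "0 \<le> F" "F \<le> 1" for F
    proof (cases "F = 1")
      case False
      then have "kelly p q F \<le> kelly p q F_K"
        using kelly_strict_increasing[of F F_K p q] kelly_strict_decreasing[of F_K p q F] that FK q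
        by (cases F F_K rule: linorder_cases) auto
      then show ?thesis
        using U that False FK by simp
    qed (simp add: U1)
    then show ?thesis
      using FK by (auto simp: is_arg_max_def not_less)
  qed
  moreover have "has_ereal_derivative U 0 F_K"
  proof -
    \<comment> \<open>The identity with \<open>kelly\<close> holds on a whole neighbourhood of
      \<open>F_K\<close>, which yields the finiteness of \<open>U\<close> there and transfers the
      derivative.\<close>
    have "\<forall>\<^sub>F F in nhds F_K. F \<in> {-1<..<1}"
      using FK by (intro eventually_nhds_in_open) auto
    then have ev: "\<forall>\<^sub>F F in nhds F_K. U F = ereal (kelly p q F)"
      by eventually_elim (simp add: U)
    have "(kelly p q has_real_derivative 0) (at F_K)"
      using has_real_derivative_kelly[of F_K p q] FK q by simp
    moreover have "\<forall>\<^sub>F F in nhds F_K. real_of_ereal (U F) = kelly p q F"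
      using ev by eventually_elim simp
    ultimately have "((\<lambda>F. real_of_ereal (U F)) has_real_derivative 0) (at F_K)"
      by (subst DERIV_cong_ev[OF refl _ refl])
    moreover have "\<forall>\<^sub>F F in nhds F_K. \<bar>U F\<bar> \<noteq> \<infinity>"
      using ev by eventually_elim simp
    ultimately show ?thesis
      by (simp add: has_ereal_derivative_def)
  qed
  moreover have "\<forall>F \<in> {0<..F_K} \<union> {F_K<..<z}. U F > 0"
    using pos z FK by auto
  ultimately show ?thesis
    using neg zero U1 by (intro exI[of _ z]) auto
qed

end
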